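(* Let $(X,\mathcal B)$ be a Steiner system $S(2,\ell,m)$ with $m>\ell$, where $X=[m]$ and $\mathcal B=\{B_1,\dots,B_b\}$, $b=|\mathcal B|$. For $j\in[m]$ let $C_j=\{i\in[b]: j\in B_i\}$. Then $\{C_1,\dots,C_m\}$ is a $(b,\ell b,k,m;r)$-MCBC for any integers $r,k$ with $\lfloor\frac{\ell}{2}\rfloor+1\leq r\leq \ell$ and $r\le k\leq (\ell-r+1)(2r-1)$.
   Context: A Steiner system $S(2,\ell,m)$ is a pair $(X,\mathcal B)$ where $X$ is a set of $m$ points and $\mathcal B$ is a collection of $\ell$-subsets (blocks) of $X$ such that every pair of distinct points of $X$ lies in exactly one block. An $(n,N,k,m;r)$ multiset combinatorial batch code (MCBC) is a collection $\mathcal C=\{C_1,\dots,C_m\}$ of subsets of $[n]=\{1,\dots,n\}$ (servers) with $N=\sum_{j=1}^m|C_j|$, such that for every multiset request $\{i_1,\dots,i_k\}$ of $k$ elements of $[n]$ in which every element has multiplicity at most $r$, there exist subsets $D_j\subseteq C_j$ with $|D_j|\le 1$ ($j\in[m]$) whose multiset union (the multiplicity of $i$ being $|\{j: i\in D_j\}|$) contains the request. *)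

theory Defs
  imports Main "HOL-Library.Multiset"
begin

definition steiner_system :: "nat \<Rightarrow> nat \<Rightarrow> 'a set \<Rightarrow> 'a set set \<Rightarrow> bool" where
  "steiner_system l m X \<B> \<longleftrightarrow>
     finite X \<and> card X = m \<and>
     (\<forall>B\<in>\<B>. B \<subseteq> X \<and> card B = l) \<and>
     (\<forall>x\<in>X. \<forall>y\<in>X. x \<noteq> y \<longrightarrow> (\<exists>!B. B \<in> \<B> \<and> x \<in> B \<and> y \<in> B))"

(* The code is the indexed family C 1, ..., C m: repeated members are allowed, and values
   of C outside {1..m} are irrelevant. *)
definition is_MCBC :: "nat \<Rightarrow> nat \<Rightarrow> nat \<Rightarrow> nat \<Rightarrow> nat \<Rightarrow> (nat \<Rightarrow> nat set) \<Rightarrow> bool" where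
  "is_MCBC n N k m r C \<longleftrightarrow>
     (\<forall>j\<in>{1..m}. C j \<subseteq> {1..n}) \<and>
     N = (\<Sum>j=1..m. card (C j)) \<and>
     (\<forall>R :: nat multiset.
        set_mset R \<subseteq> {1..n} \<and> size R = k \<and> (\<forall>i. count R i \<le> r) \<longrightarrow>
        (\<exists>D :: nat \<Rightarrow> nat set.
           (\<forall>j\<in>{1..m}. D j \<subseteq> C j \<and> card (D j) \<le> 1) \<and>
           (\<forall>i. count R i \<le> card {j\<in>{1..m}. i \<in> D j})))"

end

theory Submission
  imports Defs
begin

text \<open>
  Serving a request amounts to assigning distinct points to the requested copies of blocks, each
  point on its block, so Hall's condition has to be checked. Two blocks share at most one point,
  hence \<open>s\<close> blocks cover at least \<open>s l - s (s - 1) / 2\<close> points. For \<open>s \<le> 2 (l - r) + 1\<close> this is at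
  least \<open>r s\<close>, which bounds the number of requested copies of these blocks; otherwise already
  \<open>2 (l - r + 1)\<close> of the blocks cover \<open>(l - r + 1) (2 r - 1) \<ge> k\<close> points.
\<close>

text \<open>Induction on \<open>card I\<close>. If some nonempty proper subfamily is tight, it is
  matched inside its own union and the remaining indices are matched outside that union. If none is
  tight, one index can take any element of its set and the others still satisfy the
  condition.\<close>

theorem hall_marriage:
  assumes "finite I" and "\<And>i. i \<in> I \<Longrightarrow> finite (A i)"
    and "\<And>J. J \<subseteq> I \<Longrightarrow> card J \<le> card (\<Union>(A ` J))"
  shows "\<exists>f. inj_on f I \<and> (\<forall>i\<in>I. f i \<in> A i)"
  using assms
proof (induction "card I" arbitrary: I A rule: less_induct)
  case less
  note fin = less.prems(1) and finA = less.prems(2) and hall = less.prems(3)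
  show ?case
  proof (cases "\<exists>J. J \<subset> I \<and> J \<noteq> {} \<and> card (\<Union>(A ` J)) = card J")
    case True
    then obtain J where J: "J \<subset> I" "J \<noteq> {}" and tight: "card (\<Union>(A ` J)) = card J"
      by blast
    have finJ: "finite J" using J fin finite_subset by blast
    let ?U = "\<Union>(A ` J)"
    have finU: "finite ?U" using finJ J finA by blast
    have "\<exists>f. inj_on f J \<and> (\<forall>i\<in>J. f i \<in> A i)"
    proof (rule less.hyps)
      show "card J < card I" using J fin by (simp add: psubset_card_mono)
    qed (use J finJ finA hall in \<open>auto dest: subset_trans\<close>)
    then obtain f where f: "inj_on f J" "\<forall>i\<in>J. f i \<in> A i" by blast
    have "\<exists>g. inj_on g (I - J) \<and> (\<forall>i\<in>I - J. g i \<in> A i - ?U)"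
    proof (rule less.hyps)
      show "card (I - J) < card I" using J fin by (intro psubset_card_mono) auto
    next
      fix K assume K: "K \<subseteq> I - J"
      have finK: "finite K" using K fin finite_subset by blast
      \<comment> \<open>Hall's condition for the sets with \<open>?U\<close> removed comes from the
        condition for \<open>K \<union> J\<close>: by tightness, deleting \<open>?U\<close> costs
        exactly \<open>card J\<close>.\<close>
      have "card K + card J = card (K \<union> J)"
        using K finK finJ by (subst card_Un_disjoint) auto
      also have "\<dots> \<le> card (\<Union>(A ` (K \<union> J)))" using K J by (intro hall) auto
      also have "\<Union>(A ` (K \<union> J)) = (\<Union>i\<in>K. A i - ?U) \<union> ?U" by auto
      also have "card \<dots> \<le> card (\<Union>i\<in>K. A i - ?U) + card ?U" by (rule card_Un_le)
      finally show "card K \<le> card (\<Union>i\<in>K. A i - ?U)" using tight by simp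
    qed (use fin finA in auto)
    then obtain g where g: "inj_on g (I - J)" "\<forall>i\<in>I - J. g i \<in> A i - ?U" by blast
    let ?h = "\<lambda>i. if i \<in> J then f i else g i"
    have "inj_on ?h (J \<union> (I - J))"
    proof (rule inj_on_disjoint_Un[OF f(1) g(1)])
      show "f ` J \<inter> g ` (I - J) = {}" using f(2) g(2) by auto
    qed
    moreover have "J \<union> (I - J) = I" using J by auto
    ultimately have "inj_on ?h I" by simp
    then show ?thesis using f g J by (intro exI[of _ ?h]) auto
  next
    case no_tight: False
    show ?thesis
    proof (cases "I = {}")
      case nonempty: False
      then obtain a where a: "a \<in> I" by blast
      have "card {a} \<le> card (\<Union>(A ` {a}))" using a by (intro hall) auto
      then obtain x where x: "x \<in> A a" by fastforce
      have "\<exists>f. inj_on f (I - {a}) \<and> (\<forall>i\<in>I - {a}. f i \<in> A i - {x})"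
      proof (rule less.hyps)
        show "card (I - {a}) < card I" using a fin by (meson card_Diff1_less)
      next
        fix J assume J: "J \<subseteq> I - {a}"
        show "card J \<le> card (\<Union>i\<in>J. A i - {x})"
        proof (cases "J = {}")
          case False
          moreover have "J \<subset> I" using J a by blast
          \<comment> \<open>Without tightness the union has at least one element to spare, which
            pays for the deletion of \<open>x\<close>.\<close>
          ultimately have "card J \<noteq> card (\<Union>(A ` J))" using no_tight by metis
          moreover have "card J \<le> card (\<Union>(A ` J))" using J by (intro hall) auto
          moreover have "(\<Union>i\<in>J. A i - {x}) = \<Union>(A ` J) - {x}" by auto
          ultimately show ?thesis by (simp add: card_Diff_singleton_if) linarith
        qed simp
      qed (use fin finA in auto)
      then obtain f where f: "inj_on f (I - {a})" "\<forall>i\<in>I - {a}. f i \<in> A i - {x}" by blast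
      let ?h = "f(a := x)"
      have "inj_on ?h I"
      proof (rule inj_onI)
        fix u v assume "u \<in> I" "v \<in> I" "?h u = ?h v"
        then show "u = v" using f(2) inj_onD[OF f(1), of u v] by (auto split: if_splits)
      qed
      then show ?thesis using f x by (intro exI[of _ ?h]) auto
    qed simp
  qed
qed

text \<open>When the sets are added one at a time, a set preceded by \<open>s\<close> others meets
  their union in at most \<open>s\<close> points, so it contributes at least \<open>l - s\<close>
  new ones. Doubling the inequality and moving the overlap term to the right avoids division and
  truncated subtraction.\<close>

lemma card_Union_almost_disjoint:
  assumes "finite S" and "\<And>i. i \<in> S \<Longrightarrow> finite (B i) \<and> card (B i) = l"
    and "\<And>i j. i \<in> S \<Longrightarrow> j \<in> S \<Longrightarrow> i \<noteq> j \<Longrightarrow> card (B i \<inter> B j) \<le> 1"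
  shows "2 * l * card S \<le> 2 * card (\<Union>(B ` S)) + card S * (card S - 1)"
  using assms
proof (induction S rule: finite_induct)
  case (insert a S)
  let ?U = "\<Union>(B ` S)"
  have "card (B a \<inter> ?U) \<le> (\<Sum>i\<in>S. card (B a \<inter> B i))"
    unfolding Int_UN_distrib by (rule card_UN_le) fact
  also have "\<dots> \<le> card S"
    using sum_bounded_above[of S "\<lambda>i. card (B a \<inter> B i)" 1] insert by fastforce
  finally have "card (B a \<inter> ?U) \<le> card S" .
  moreover have "card (B a) + card ?U = card (B a \<union> ?U) + card (B a \<inter> ?U)"
    using insert by (intro card_Un_Int) auto
  ultimately have "l + card ?U \<le> card (\<Union>(B ` insert a S)) + card S"
    using insert.prems by simp
  moreover have "2 * l * card S \<le> 2 * card ?U + card S * (card S - 1)"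
    using insert by simp
  moreover have "Suc (card S) * card S = card S * (card S - 1) + 2 * card S"
    by (cases "card S") auto
  ultimately show ?case using insert.hyps by (simp add: distrib_left distrib_right)
qed simp

text \<open>Two common points would be a pair lying in two different blocks.\<close>

lemma steiner_system_card_Int:
  assumes "steiner_system l m X \<B>" and "P \<in> \<B>" "Q \<in> \<B>" "P \<noteq> Q"
  shows "card (P \<inter> Q) \<le> 1"
proof -
  have "x = y" if "x \<in> P \<inter> Q" "y \<in> P \<inter> Q" for x y
    using assms that unfolding steiner_system_def by (metis IntD1 IntD2 subsetD)
  then show ?thesis
    by (cases "finite (P \<inter> Q)") (auto simp: card_le_Suc0_iff_eq)
qed

text \<open>This is Hall's condition in numerical form: \<open>t\<close> stands for a number of
  requested copies, bounded both by the multiplicity limit on the blocks in \<open>S\<close> and by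
  the length of the request.\<close>

lemma card_Union_ge_request:
  fixes l r k :: nat
  assumes "finite S" and "\<And>i. i \<in> S \<Longrightarrow> finite (B i) \<and> card (B i) = l"
    and "\<And>i j. i \<in> S \<Longrightarrow> j \<in> S \<Longrightarrow> i \<noteq> j \<Longrightarrow> card (B i \<inter> B j) \<le> 1"
    and "r \<le> l" and "k \<le> (l - r + 1) * (2 * r - 1)"
    and "t \<le> r * card S" and "t \<le> k"
  shows "t \<le> card (\<Union>(B ` S))"
proof (cases "card S \<le> 2 * (l - r) + 1")
  case True
  have "card S - 1 \<le> 2 * (l - r)" using True by simp
  then have "card S * (card S - 1) \<le> card S * (2 * (l - r))"
    by (rule mult_left_mono) simp
  \<comment> \<open>The first summand absorbs the overlap term, and the second is twice the bound on
    \<open>t\<close>.\<close>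
  moreover have "2 * l * card S = card S * (2 * (l - r)) + 2 * (r * card S)"
    using \<open>r \<le> l\<close> by (auto simp: algebra_simps diff_mult_distrib2 dest: le_Suc_ex)
  ultimately show ?thesis
    using card_Union_almost_disjoint[of S B l, OF assms(1-3)] \<open>t \<le> r * card S\<close> by linarith
next
  case False
  let ?q = "l - r + 1"
  \<comment> \<open>The quadratic lower bound falls for large families, so it is applied to a
    subfamily of the least size above the threshold, which is \<open>2 * ?q\<close>.\<close>
  have "2 * ?q \<le> card S" using False by simp
  then obtain T where T: "T \<subseteq> S" "card T = 2 * ?q"
    by (rule obtain_subset_with_card_n)
  have "finite T" using T assms(1) finite_subset by blast
  have "2 * l * card T \<le> 2 * card (\<Union>(B ` T)) + card T * (card T - 1)"
    using T \<open>finite T\<close> assms by (intro card_Union_almost_disjoint) blast+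
  \<comment> \<open>This rests on \<open>2 * l - (2 * ?q - 1) = 2 * r - 1\<close>. For
    \<open>r = 0\<close> the right side truncates to 0, and the bound drawn from it is
    trivial.\<close>
  moreover have "2 * l * (2 * ?q) = 2 * (?q * (2 * r - 1)) + 2 * ?q * (2 * ?q - 1)" if r_pos: "0 < r"
  proof -
    obtain d where "l = r + d" using \<open>r \<le> l\<close> le_Suc_ex by blast
    moreover obtain p where "r = Suc p" using r_pos by (cases r) auto
    ultimately show ?thesis by (simp add: algebra_simps)
  qed
  ultimately have "?q * (2 * r - 1) \<le> card (\<Union>(B ` T))"
    using T by (cases "r = 0") auto
  also have "\<dots> \<le> card (\<Union>(B ` S))"
    using T assms(1,2) by (intro card_mono) auto
  finally show ?thesis using assms by linarith
qed

theorem theorem12: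
  fixes l m b r k :: nat
    and \<B> :: "nat set set"
    and B C :: "nat \<Rightarrow> nat set"
  assumes "steiner_system l m {1..m} \<B>"
    and "m > l"
    and "b = card \<B>"
    and "bij_betw B {1..b} \<B>"
    and "\<And>j. j \<in> {1..m} \<Longrightarrow> C j = {i \<in> {1..b}. j \<in> B i}"
    and "l div 2 + 1 \<le> r" and "r \<le> l"
    and "r \<le> k" and "k \<le> (l - r + 1) * (2 * r - 1)"
  shows "is_MCBC b (l * b) k m r C"
proof -
  have B: "B i \<in> \<B>" "B i \<subseteq> {1..m}" "card (B i) = l" "finite (B i)" if "i \<in> {1..b}" for i
    using assms(1,4) that finite_subset[of "B i" "{1..m}"]
    unfolding steiner_system_def bij_betw_def by auto
  have B_Int: "card (B i \<inter> B j) \<le> 1" if "i \<in> {1..b}" "j \<in> {1..b}" "i \<noteq> j" for i j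
  proof (rule steiner_system_card_Int[OF assms(1)])
    show "B i \<noteq> B j"
      using bij_betw_imp_inj_on[OF assms(4)] that by (auto dest: inj_onD)
  qed (use B that in auto)
  show ?thesis
    unfolding is_MCBC_def
  proof (intro conjI allI impI)
    show "\<forall>j\<in>{1..m}. C j \<subseteq> {1..b}" using assms(5) by auto
    \<comment> \<open>Incidences of points and blocks are counted twice: each of the
      \<open>b\<close> blocks has \<open>l\<close> points.\<close>
    have "(\<Sum>j=1..m. card (C j)) = (\<Sum>j=1..m. card {i \<in> {1..b}. j \<in> B i})"
      using assms(5) by simp
    also have "\<dots> = l * card {1..b}"
    proof (rule sum_multicount)
      have "{j \<in> {1..m}. j \<in> B i} = B i" if "i \<in> {1..b}" for i using B(2)[OF that] by auto
      then show "\<forall>i\<in>{1..b}. card {j \<in> {1..m}. j \<in> B i} = l" using B(3) by simp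
    qed auto
    finally show "l * b = (\<Sum>j=1..m. card (C j))" by simp
  next
    fix R :: "nat multiset"
    assume R: "set_mset R \<subseteq> {1..b} \<and> size R = k \<and> (\<forall>i. count R i \<le> r)"
    \<comment> \<open>The pair \<open>(i, c)\<close> is copy number \<open>c\<close> of the
      requested \<open>i\<close>, counted from 0; it is to receive a point of the block
      \<open>B i\<close>.\<close>
    let ?I = "SIGMA i:{1..b}. {..<count R i}"
    have "\<exists>f. inj_on f ?I \<and> (\<forall>p\<in>?I. f p \<in> B (fst p))"
    proof (rule hall_marriage)
      fix J assume J: "J \<subseteq> ?I"
      \<comment> \<open>The points available to \<open>J\<close> depend only on the blocks that
        occur in it, so \<open>J\<close> is compared with all requested copies of these
        blocks.\<close>
      let ?S = "fst ` J"
      have S: "?S \<subseteq> {1..b}" using J by auto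
      then have finS: "finite ?S" using finite_subset by blast
      have "J \<subseteq> (SIGMA i:?S. {..<count R i})" using J by force
      then have "card J \<le> card (SIGMA i:?S. {..<count R i})"
        using finS by (intro card_mono) auto
      also have "\<dots> = sum (count R) ?S" using finS by (subst card_SigmaI) auto
      finally have J_le: "card J \<le> sum (count R) ?S" .
      have "sum (count R) ?S \<le> sum (count R) {1..b}" using S by (intro sum_mono2) auto
      also have "\<dots> = size R" unfolding size_multiset_overloaded_eq
        using R by (intro sum.mono_neutral_right) (auto simp: not_in_iff)
      finally have "card J \<le> k" using J_le R by simp
      moreover have "sum (count R) ?S \<le> r * card ?S"
        using sum_bounded_above[of ?S "count R" r] R by (simp add: mult.commute)
      ultimately have J_bounds: "card J \<le> r * card ?S" "card J \<le> k" using J_le by linarith+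
      have "card J \<le> card (\<Union>(B ` ?S))"
      proof (rule card_Union_ge_request[OF finS _ _ \<open>r \<le> l\<close> assms(9) J_bounds])
        show "finite (B i) \<and> card (B i) = l" if "i \<in> ?S" for i
          using B(3,4) subsetD[OF S that] by simp
        show "card (B i \<inter> B j) \<le> 1" if "i \<in> ?S" "j \<in> ?S" "i \<noteq> j" for i j
          using B_Int[OF subsetD[OF S that(1)] subsetD[OF S that(2)] that(3)] .
      qed
      then show "card J \<le> card (\<Union>p\<in>J. B (fst p))" by (simp add: image_image)
    qed (use B in auto)
    then obtain f where inj: "inj_on f ?I" and f: "\<And>p. p \<in> ?I \<Longrightarrow> f p \<in> B (fst p)"
      by blast
    \<comment> \<open>\<open>?D j\<close> holds the index whose copy was assigned the point
      \<open>j\<close>, and is empty if \<open>j\<close> was not assigned. Injectivity of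
      \<open>f\<close> leaves at most one such index.\<close>
    let ?D = "\<lambda>j. {i. \<exists>c. (i, c) \<in> ?I \<and> f (i, c) = j}"
    have D_sub: "?D j \<subseteq> C j" if "j \<in> {1..m}" for j
      using f assms(5)[OF that] by force
    have "card (?D j) \<le> 1" for j
    proof -
      have "i = i'" if "i \<in> ?D j" "i' \<in> ?D j" for i i'
      proof -
        obtain c c' where "(i, c) \<in> ?I" "(i', c') \<in> ?I" "f (i, c) = f (i', c')"
          using \<open>i \<in> ?D j\<close> \<open>i' \<in> ?D j\<close> by auto
        then show ?thesis using inj_onD[OF inj] by blast
      qed
      moreover have "finite (?D j)" by (rule finite_subset[of _ "{1..b}"]) auto
      ultimately show ?thesis by (auto simp: card_le_Suc0_iff_eq)
    qed
    moreover have "count R i \<le> card {j \<in> {1..m}. i \<in> ?D j}" for i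
    proof (cases "i \<in> {1..b}")
      case True
      \<comment> \<open>The copies of a fixed \<open>i\<close> go to distinct points
        \<open>j\<close>, each with \<open>i \<in> ?D j\<close>, so \<open>i\<close> is retrieved at
        least \<open>count R i\<close> times.\<close>
      have "inj_on (\<lambda>c. f (i, c)) {..<count R i}"
      proof (rule inj_onI)
        fix c c' assume "c \<in> {..<count R i}" "c' \<in> {..<count R i}" "f (i, c) = f (i, c')"
        then show "c = c'" using inj_onD[OF inj, of "(i, c)" "(i, c')"] True by simp
      qed
      then have "count R i = card ((\<lambda>c. f (i, c)) ` {..<count R i})" by (simp add: card_image)
      also have "\<dots> \<le> card {j \<in> {1..m}. i \<in> ?D j}"
      proof (rule card_mono)
        have "f (i, c) \<in> {1..m}" if "c < count R i" for c
          using f[of "(i, c)"] B(2)[OF True] True that by auto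
        then show "(\<lambda>c. f (i, c)) ` {..<count R i} \<subseteq> {j \<in> {1..m}. i \<in> ?D j}"
          using True by auto
      qed simp
      finally show ?thesis .
    next
      case False
      then have "count R i = 0" using R by (meson count_eq_zero_iff subsetD)
      then show ?thesis by simp
    qed
    ultimately show "\<exists>D. (\<forall>j\<in>{1..m}. D j \<subseteq> C j \<and> card (D j) \<le> 1) \<and>
        (\<forall>i. count R i \<le> card {j \<in> {1..m}. i \<in> D j})"
      using D_sub by (intro exI[of _ ?D]) auto
  qed
qed

end
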